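(* Suppose there exist an open interval $I\subset\mathbb R$, $\bar\alpha>0$ and $K>0$ such that, for every $R\in I$, there exists $(\xi,a)\in S(X,u,c,R)$ satisfying $\alpha(\xi)>\bar\alpha$ and $\mathbb E^a\big[1/u'(\hat\xi_{\bar\alpha})\big]\le K$. Then $V(X,u,c,\cdot)$ is continuous on $I$.
   Context: Setting (standard Principal-Agent problem). $(\Omega,\mathcal F,\mathbb P)$ is a probability space with a real random variable $X$; $A\subset\mathbb R$ is nonempty and compact; for each $a\in A$, $\mathbb P^a$ is a probability measure, absolutely continuous with respect to $\mathbb P$, with expectation $\mathbb E^a$; $\Xi$ is a set of real $\sigma(X)$-measurable random variables (contracts); $c:A\to\mathbb R$ is convex, differentiable and strictly increasing; $u:\mathbb R\to\mathbb R$ is concave, differentiable and strictly increasing. For $\xi\in\Xi$ the upper-gap is $\alpha(\xi):=\sup\{\delta\in\mathbb R:u(\xi)+\delta\le\sup u(\mathbb R)\ \mathbb P\text{-a.s.}\}\in[0,+\infty]$, and for real $\delta<\alpha(\xi)$ the perturbed contract is $\hat\xi_\delta:=u^{-1}(u(\xi)+\delta)$ ($\mathbb P$-a.s.). Admissibility of $\Xi$: for all $\xi\in\Xi$, $a\in A$, the variables $X,\xi,u(\xi)$ are $\mathbb P^a$-integrable, and $\hat\xi_\delta\in\Xi$ for every $\xi\in\Xi$ and $\delta<\alpha(\xi)$. $\Sigma:=\{(\xi,a)\in\Xi\times A:a\in\operatorname{arg\,max}_{b\in A}\mathbb E^b[u(\xi)-c(b)]\}$. For $R\in\mathbb R$,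 $V(X,u,c,R):=\sup\{\mathbb E^a[X-\xi]:(\xi,a)\in\Sigma,\ \mathbb E^a[u(\xi)-c(a)]\ge R\}$ (with $\sup\emptyset=-\infty$) and $S(X,u,c,R)$ is the set of pairs attaining this supremum. *)

theory Defs
  imports "HOL-Probability.Probability"
begin

text \<open>
  The action set is an arbitrary nonempty compact set of reals, not necessarily an interval, whereas
  \<^const>\<open>convex_on\<close> presupposes a convex domain. Convexity of the cost is therefore required only
  at those convex combinations that are themselves actions; on a convex domain this is
  \<^const>\<open>convex_on\<close> (lemma \<open>convex_rel_on_iff\<close>).
\<close>
definition convex_rel_on :: "real set \<Rightarrow> (real \<Rightarrow> real) \<Rightarrow> bool" where
  "convex_rel_on A f \<longleftrightarrow>
     (\<forall>x\<in>A. \<forall>y\<in>A. \<forall>t\<in>{0..1}. (1 - t) * x + t * y \<in> A \<longrightarrow>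
        f ((1 - t) * x + t * y) \<le> (1 - t) * f x + t * f y)"

lemma convex_rel_on_iff:
  assumes "convex A"
  shows "convex_rel_on A f \<longleftrightarrow> convex_on A f"
proof
  assume f: "convex_rel_on A f"
  show "convex_on A f"
  proof (rule convex_onI)
    fix t x y :: real
    assume "0 < t" "t < 1" "x \<in> A" "y \<in> A"
    moreover from this have "(1 - t) *\<^sub>R x + t *\<^sub>R y \<in> A"
      using assms by (intro convexD) auto
    ultimately show "f ((1 - t) *\<^sub>R x + t *\<^sub>R y) \<le> (1 - t) * f x + t * f y"
      using f unfolding convex_rel_on_def by auto
  qed (use assms in auto)
next
  assume "convex_on A f"
  then show "convex_rel_on A f"
    unfolding convex_rel_on_def by (auto dest: convex_onD)
qed

text \<open>\<open>Q a\<close> is the law \<open>\<P>\<^sup>a\<close> on \<open>\<Omega>\<close> induced by action \<open>a\<close>.\<close>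
locale principal_agent = prob_space M
  for M :: "'w measure" +
  fixes X :: "'w \<Rightarrow> real" and A :: "real set" and Q :: "real \<Rightarrow> 'w measure"
    and \<Xi> :: "('w \<Rightarrow> real) set" and c :: "real \<Rightarrow> real" and u :: "real \<Rightarrow> real"
  assumes X_measurable: "X \<in> borel_measurable M"
    and A_nonempty: "A \<noteq> {}"
    and A_compact: "compact A"
    and Q_prob: "\<And>a. a \<in> A \<Longrightarrow> prob_space (Q a)"
    and Q_sets: "\<And>a. a \<in> A \<Longrightarrow> sets (Q a) = sets M"
    and Q_ac: "\<And>a. a \<in> A \<Longrightarrow> absolutely_continuous M (Q a)"
    and contract_measurable:
      "\<And>\<xi>. \<xi> \<in> \<Xi> \<Longrightarrow> \<xi> \<in> borel_measurable (vimage_algebra (space M) X borel)"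
    and c_convex: "convex_rel_on A c"
    and c_differentiable: "c differentiable_on A"
    and c_strict_mono: "strict_mono_on A c"
    and u_concave: "concave_on UNIV u"
    and u_differentiable: "u differentiable_on UNIV"
    and u_strict_mono: "strict_mono u"

definition upper_gap :: "'w measure \<Rightarrow> (real \<Rightarrow> real) \<Rightarrow> ('w \<Rightarrow> real) \<Rightarrow> ereal" where
  "upper_gap M u \<xi> =
     Sup (ereal ` {\<delta>. AE \<omega> in M. ereal (u (\<xi> \<omega>) + \<delta>) \<le> (SUP x. ereal (u x))})"

text \<open>
  For \<open>\<delta>\<close> below the upper gap, \<open>u (\<xi> \<omega>) + \<delta>\<close> lies in the range of \<open>u\<close> almost surely; the
  values on the exceptional null set are arbitrary.
\<close>
definition perturbed :: "(real \<Rightarrow> real) \<Rightarrow> ('w \<Rightarrow> real) \<Rightarrow> real \<Rightarrow> 'w \<Rightarrow> real" where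
  "perturbed u \<xi> \<delta> = (\<lambda>\<omega>. inv u (u (\<xi> \<omega>) + \<delta>))"

text \<open>
  Contracts are functions rather than classes modulo null sets, and perturbed contracts are
  determined only almost surely; hence closure asks for a version of the perturbed contract in \<open>\<Xi>\<close>.
\<close>
definition admissible ::
  "'w measure \<Rightarrow> ('w \<Rightarrow> real) \<Rightarrow> real set \<Rightarrow> (real \<Rightarrow> 'w measure) \<Rightarrow> ('w \<Rightarrow> real) set
    \<Rightarrow> (real \<Rightarrow> real) \<Rightarrow> bool" where
  "admissible M X A Q \<Xi> u \<longleftrightarrow>
     (\<forall>\<xi>\<in>\<Xi>. \<forall>a\<in>A. integrable (Q a) X \<and> integrable (Q a) \<xi> \<and>
        integrable (Q a) (\<lambda>\<omega>. u (\<xi> \<omega>))) \<and>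
     (\<forall>\<xi>\<in>\<Xi>. \<forall>\<delta>::real. ereal \<delta> < upper_gap M u \<xi> \<longrightarrow>
        (\<exists>\<eta>\<in>\<Xi>. AE \<omega> in M. \<eta> \<omega> = perturbed u \<xi> \<delta> \<omega>))"

definition agent_utility ::
  "(real \<Rightarrow> 'w measure) \<Rightarrow> (real \<Rightarrow> real) \<Rightarrow> (real \<Rightarrow> real) \<Rightarrow> ('w \<Rightarrow> real) \<Rightarrow> real \<Rightarrow> real" where
  "agent_utility Q u c \<xi> a = (\<integral>\<omega>. u (\<xi> \<omega>) - c a \<partial>Q a)"

definition principal_profit ::
  "(real \<Rightarrow> 'w measure) \<Rightarrow> ('w \<Rightarrow> real) \<Rightarrow> ('w \<Rightarrow> real) \<Rightarrow> real \<Rightarrow> real" where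
  "principal_profit Q X \<xi> a = (\<integral>\<omega>. X \<omega> - \<xi> \<omega> \<partial>Q a)"

definition incentive_compatible ::
  "real set \<Rightarrow> (real \<Rightarrow> 'w measure) \<Rightarrow> ('w \<Rightarrow> real) set \<Rightarrow> (real \<Rightarrow> real) \<Rightarrow> (real \<Rightarrow> real)
    \<Rightarrow> (('w \<Rightarrow> real) \<times> real) set" where
  "incentive_compatible A Q \<Xi> u c =
     {(\<xi>, a). \<xi> \<in> \<Xi> \<and> is_arg_max (agent_utility Q u c \<xi>) (\<lambda>b. b \<in> A) a}"

definition feasible ::
  "real set \<Rightarrow> (real \<Rightarrow> 'w measure) \<Rightarrow> ('w \<Rightarrow> real) set \<Rightarrow> (real \<Rightarrow> real) \<Rightarrow> (real \<Rightarrow> real) \<Rightarrow> real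
    \<Rightarrow> (('w \<Rightarrow> real) \<times> real) set" where
  "feasible A Q \<Xi> u c R =
     {(\<xi>, a) \<in> incentive_compatible A Q \<Xi> u c. agent_utility Q u c \<xi> a \<ge> R}"

definition PA_value ::
  "real set \<Rightarrow> (real \<Rightarrow> 'w measure) \<Rightarrow> ('w \<Rightarrow> real) set \<Rightarrow> ('w \<Rightarrow> real) \<Rightarrow> (real \<Rightarrow> real)
    \<Rightarrow> (real \<Rightarrow> real) \<Rightarrow> real \<Rightarrow> ereal" where
  "PA_value A Q \<Xi> X u c R =
     (SUP (\<xi>, a) \<in> feasible A Q \<Xi> u c R. ereal (principal_profit Q X \<xi> a))"

definition PA_solutions ::
  "real set \<Rightarrow> (real \<Rightarrow> 'w measure) \<Rightarrow> ('w \<Rightarrow> real) set \<Rightarrow> ('w \<Rightarrow> real) \<Rightarrow> (real \<Rightarrow> real)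
    \<Rightarrow> (real \<Rightarrow> real) \<Rightarrow> real \<Rightarrow> (('w \<Rightarrow> real) \<times> real) set" where
  "PA_solutions A Q \<Xi> X u c R =
     {(\<xi>, a) \<in> feasible A Q \<Xi> u c R.
        ereal (principal_profit Q X \<xi> a) = PA_value A Q \<Xi> X u c R}"

end

theory Submission imports Defs begin

text \<open>
  Raising a contract by \<open>\<delta>\<close> units of utility raises the agent's expected utility by exactly \<open>\<delta>\<close>
  under every action, since expectations are taken under probability measures. The set of the
  agent's best replies is thus unchanged, and a contract feasible at reservation utility \<open>R\<close> becomes
  feasible at \<open>R + \<delta>\<close>. Concavity bounds its cost to the principal: the tangent of \<open>u\<close> at the raised
  wage lies above \<open>u\<close>, so the pointwise raise is at most \<open>\<delta>\<close> divided by the marginal utility there,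
  and this marginal utility is at least that at the raise by \<open>\<alpha>bar\<close> as long as \<open>\<delta> \<le> \<alpha>bar\<close>.
  Integrating, the raise costs at most \<open>K \<delta>\<close> (lemma \<open>PA_value_perturbation\<close>).

  Applied to an optimal contract at \<open>R\<close>, this gives \<open>V(R) - K \<delta> \<le> V(R + \<delta>)\<close>, while
  \<open>V(R + \<delta>) \<le> V(R)\<close> because a higher reservation utility shrinks the feasible set. The constants
  \<open>\<alpha>bar\<close> and \<open>K\<close> are the same for every \<open>R\<close> in \<open>I\<close>, so the two bounds together say that \<open>V\<close> is
  \<open>K\<close>-Lipschitz between any two points of \<open>I\<close> at distance at most \<open>\<alpha>bar\<close>.
\<close>

section \<open>Concave, differentiable, strictly increasing utilities\<close>

lemma concave_below_tangent:
  fixes u :: "real \<Rightarrow> real"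
  assumes "concave_on UNIV u" and "u differentiable_on UNIV"
  shows "u y \<le> u x + deriv u x * (y - x)"
proof -
  have "(u has_real_derivative deriv u x) (at x)"
    using assms(2) by (auto simp: differentiable_on_def DERIV_deriv_iff_real_differentiable)
  then have "((\<lambda>z. - u z) has_real_derivative - deriv u x) (at x)"
    by (rule DERIV_minus)
  moreover have "convex_on UNIV (\<lambda>z. - u z)"
    using assms(1) by (simp add: concave_on_def)
  ultimately have "- u y - (- u x) \<ge> - deriv u x * (y - x)"
    by (intro convex_on_imp_above_tangent[where A = UNIV]) auto
  then show ?thesis by simp
qed

lemma concave_deriv_antimono:
  fixes u :: "real \<Rightarrow> real"
  assumes "concave_on UNIV u" and "u differentiable_on UNIV" and "x \<le> y"
  shows "deriv u y \<le> deriv u x"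
proof (cases "x = y")
  case False
  with assms(3) have "x < y" by simp
  have "u y \<le> u x + deriv u x * (y - x)" "u x \<le> u y + deriv u y * (x - y)"
    using assms(1,2) by (rule concave_below_tangent)+
  then have "deriv u y * (y - x) \<le> deriv u x * (y - x)"
    by (simp add: algebra_simps)
  with \<open>x < y\<close> show ?thesis by (simp add: mult_le_cancel_right)
qed simp

text \<open>A nonpositive slope anywhere would keep the tangent, and with it \<open>u\<close>, from rising beyond.\<close>
lemma concave_strict_mono_deriv_pos:
  fixes u :: "real \<Rightarrow> real"
  assumes "concave_on UNIV u" and "u differentiable_on UNIV" and "strict_mono u"
  shows "deriv u x > 0"
proof -
  have "u x < u (x + 1)" using assms(3) by (simp add: strict_mono_less)
  also have "\<dots> \<le> u x + deriv u x * ((x + 1) - x)"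
    using assms(1,2) by (rule concave_below_tangent)
  finally show ?thesis by simp
qed

text \<open>
  The wage needed for \<open>\<delta>\<close> more units of utility is bounded by the marginal utility at the far end
  \<open>z\<close> of the range of raises, a bound uniform in \<open>\<delta>\<close>.
\<close>
lemma concave_raise_bound:
  fixes u :: "real \<Rightarrow> real"
  assumes "concave_on UNIV u" and "u differentiable_on UNIV" and "strict_mono u"
    and "u y = u x + \<delta>" and "0 \<le> \<delta>" and "y \<le> z"
  shows "y - x \<le> \<delta> * (1 / deriv u z)"
proof -
  have "u x \<le> u y + deriv u y * (x - y)"
    using assms(1,2) by (rule concave_below_tangent)
  then have "deriv u y * (y - x) \<le> \<delta>"
    using assms(4) by (simp add: algebra_simps)
  moreover have "x \<le> y"
    using assms(3-5) by (metis le_add_same_cancel1 strict_mono_less_eq)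
  moreover have "deriv u z \<le> deriv u y"
    using assms(1,2,6) by (rule concave_deriv_antimono)
  ultimately have "deriv u z * (y - x) \<le> \<delta>"
    by (meson diff_ge_0_iff_ge mult_right_mono order_trans)
  then show ?thesis
    using concave_strict_mono_deriv_pos[OF assms(1-3), of z] by (simp add: field_simps)
qed

section \<open>Raising a contract\<close>

text \<open>
  Below the upper gap the raised utility stays strictly under the supremum of \<open>u\<close>, so by the
  intermediate value theorem it is attained, and the inverse in the perturbed contract is genuine.
\<close>
lemma AE_utility_perturbed:
  assumes "u differentiable_on UNIV" and "0 \<le> \<delta>" and "ereal \<delta> < upper_gap M u \<xi>"
  shows "AE \<omega> in M. u (perturbed u \<xi> \<delta> \<omega>) = u (\<xi> \<omega>) + \<delta>"
proof -
  obtain \<delta>' where "\<delta> < \<delta>'"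
    and ae: "AE \<omega> in M. ereal (u (\<xi> \<omega>) + \<delta>') \<le> (SUP x. ereal (u x))"
    using assms(3) by (auto simp: upper_gap_def less_Sup_iff)
  from ae show ?thesis
  proof eventually_elim
    case (elim \<omega>)
    have "ereal (u (\<xi> \<omega>) + \<delta>) < ereal (u (\<xi> \<omega>) + \<delta>')" using \<open>\<delta> < \<delta>'\<close> by simp
    also note elim
    finally obtain y where y: "u (\<xi> \<omega>) + \<delta> < u y" by (auto simp: less_SUP_iff)
    have "connected (range u)"
      using assms(1) by (intro connected_continuous_image differentiable_imp_continuous_on) auto
    from connectedD_interval[OF this rangeI rangeI, of "\<xi> \<omega>" _ y]
    have "u (\<xi> \<omega>) + \<delta> \<in> range u"
      using y assms(2) by simp
    then show ?case by (simp add: perturbed_def f_inv_into_f)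
  qed
qed

lemma PA_value_antimono:
  assumes "R \<le> R'"
  shows "PA_value A Q \<Xi> X u c R' \<le> PA_value A Q \<Xi> X u c R"
  unfolding PA_value_def using assms
  by (intro SUP_subset_mono) (auto simp: feasible_def)

context principal_agent
begin

lemma AE_Q:
  assumes "a \<in> A" and "AE \<omega> in M. P \<omega>"
  shows "AE \<omega> in Q a. P \<omega>"
  using absolutely_continuous_AE[OF Q_sets[OF assms(1)] Q_ac[OF assms(1)] assms(2)] .

lemma agent_utility_raise:
  assumes "admissible M X A Q \<Xi> u" and "\<xi> \<in> \<Xi>" and "\<eta> \<in> \<Xi>" and "b \<in> A"
    and "AE \<omega> in M. u (\<eta> \<omega>) = u (\<xi> \<omega>) + \<delta>"
  shows "agent_utility Q u c \<eta> b = agent_utility Q u c \<xi> b + \<delta>"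
proof -
  interpret Qb: prob_space "Q b" using Q_prob[OF assms(4)] .
  have int: "integrable (Q b) (\<lambda>\<omega>. u (\<xi> \<omega>))" "integrable (Q b) (\<lambda>\<omega>. u (\<eta> \<omega>))"
    using assms(1-4) by (auto simp: admissible_def)
  have "agent_utility Q u c \<eta> b = (\<integral>\<omega>. (u (\<xi> \<omega>) - c b) + \<delta> \<partial>Q b)"
    unfolding agent_utility_def
    using AE_Q[OF assms(4,5)] int by (intro integral_cong_AE) auto
  also have "\<dots> = agent_utility Q u c \<xi> b + \<delta>"
    unfolding agent_utility_def using int
    by (subst Bochner_Integration.integral_add) (auto simp: Qb.prob_space)
  finally show ?thesis .
qed

text \<open>
  The agent gains the same \<open>\<delta>\<close> under every action, so incentive compatibility survives the raise
  and the contract now meets a participation constraint that is tighter by \<open>\<delta>\<close>.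
\<close>
lemma feasible_raise:
  assumes "admissible M X A Q \<Xi> u" and "(\<xi>, a) \<in> feasible A Q \<Xi> u c R" and "\<eta> \<in> \<Xi>"
    and "AE \<omega> in M. u (\<eta> \<omega>) = u (\<xi> \<omega>) + \<delta>"
  shows "(\<eta>, a) \<in> feasible A Q \<Xi> u c (R + \<delta>)"
proof -
  have "\<xi> \<in> \<Xi>" using assms(2) by (simp add: feasible_def incentive_compatible_def)
  then have "agent_utility Q u c \<eta> b = agent_utility Q u c \<xi> b + \<delta>" if "b \<in> A" for b
    using assms(1,3,4) that by (intro agent_utility_raise) auto
  then show ?thesis
    using assms(2,3)
    by (auto simp: feasible_def incentive_compatible_def is_arg_max_linorder)
qed

lemma PA_value_perturbation:
  assumes adm: "admissible M X A Q \<Xi> u"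
    and feas: "(\<xi>, a) \<in> feasible A Q \<Xi> u c R"
    and \<delta>: "0 \<le> \<delta>" "\<delta> \<le> \<alpha>" and gap: "ereal \<alpha> < upper_gap M u \<xi>"
    and int: "integrable (Q a) (\<lambda>\<omega>. 1 / deriv u (perturbed u \<xi> \<alpha> \<omega>))"
    and le_K: "(\<integral>\<omega>. 1 / deriv u (perturbed u \<xi> \<alpha> \<omega>) \<partial>Q a) \<le> K"
  shows "ereal (principal_profit Q X \<xi> a - K * \<delta>) \<le> PA_value A Q \<Xi> X u c (R + \<delta>)"
proof -
  have \<xi>: "\<xi> \<in> \<Xi>" and a: "a \<in> A"
    using feas by (auto simp: feasible_def incentive_compatible_def is_arg_max_def)
  have gap\<delta>: "ereal \<delta> < upper_gap M u \<xi>"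
    using \<delta>(2) gap by (intro le_less_trans[OF _ gap]) simp
  then obtain \<eta> where \<eta>: "\<eta> \<in> \<Xi>" and ae: "AE \<omega> in M. \<eta> \<omega> = perturbed u \<xi> \<delta> \<omega>"
    using adm \<xi> unfolding admissible_def by blast
  have u\<eta>: "AE \<omega> in M. u (\<eta> \<omega>) = u (\<xi> \<omega>) + \<delta>"
    using ae AE_utility_perturbed[OF u_differentiable \<delta>(1) gap\<delta>] by eventually_elim simp
  have "AE \<omega> in M. u (perturbed u \<xi> \<alpha> \<omega>) = u (\<xi> \<omega>) + \<alpha>"
    using AE_utility_perturbed[OF u_differentiable _ gap] \<delta> by simp
  with u\<eta> have "AE \<omega> in M. \<eta> \<omega> - \<xi> \<omega> \<le> \<delta> * (1 / deriv u (perturbed u \<xi> \<alpha> \<omega>))"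
  proof eventually_elim
    case (elim \<omega>)
    then have "\<eta> \<omega> \<le> perturbed u \<xi> \<alpha> \<omega>"
      using \<delta>(2) strict_mono_less_eq[OF u_strict_mono] by (metis add_left_mono)
    with elim show ?case
      using concave_raise_bound[OF u_concave u_differentiable u_strict_mono _ \<delta>(1)] by blast
  qed
  then have "AE \<omega> in Q a. \<eta> \<omega> - \<xi> \<omega> \<le> \<delta> * (1 / deriv u (perturbed u \<xi> \<alpha> \<omega>))"
    by (rule AE_Q[OF a])
  moreover have ints: "integrable (Q a) X" "integrable (Q a) \<xi>" "integrable (Q a) \<eta>"
    using adm \<xi> \<eta> a by (auto simp: admissible_def)
  ultimately have "(\<integral>\<omega>. \<eta> \<omega> - \<xi> \<omega> \<partial>Q a) \<le> (\<integral>\<omega>. \<delta> * (1 / deriv u (perturbed u \<xi> \<alpha> \<omega>)) \<partial>Q a)"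
    using int by (intro integral_mono_AE Bochner_Integration.integrable_diff integrable_mult_right) auto
  also have "\<dots> = \<delta> * (\<integral>\<omega>. 1 / deriv u (perturbed u \<xi> \<alpha> \<omega>) \<partial>Q a)"
    by (rule integral_mult_right_zero)
  also have "\<dots> \<le> \<delta> * K" using le_K \<delta>(1) by (rule mult_left_mono)
  finally have "principal_profit Q X \<xi> a - K * \<delta> \<le> principal_profit Q X \<eta> a"
    using ints by (simp add: principal_profit_def mult.commute)
  then have "ereal (principal_profit Q X \<xi> a - K * \<delta>) \<le> ereal (principal_profit Q X \<eta> a)"
    by simp
  also have "\<dots> \<le> PA_value A Q \<Xi> X u c (R + \<delta>)"
    unfolding PA_value_def using feasible_raise[OF adm feas \<eta> u\<eta>] by (intro SUP_upper2) auto
  finally show ?thesis .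
qed

end

section \<open>Continuity of the value\<close>

lemma continuous_on_of_lipschitz_at_scale:
  fixes v :: "real \<Rightarrow> real"
  assumes "\<alpha> > 0" and "K > 0"
    and "\<And>x y. x \<in> I \<Longrightarrow> y \<in> I \<Longrightarrow> x \<le> y \<Longrightarrow> y - x \<le> \<alpha> \<Longrightarrow> \<bar>v y - v x\<bar> \<le> K * (y - x)"
  shows "continuous_on I v"
  unfolding continuous_on_iff
proof (intro ballI allI impI)
  fix x e :: real assume "x \<in> I" "0 < e"
  have "dist (v y) (v x) < e" if "y \<in> I" "dist y x < min \<alpha> (e / K)" for y
  proof -
    have "\<bar>v y - v x\<bar> \<le> K * \<bar>y - x\<bar>"
      using assms(3)[of x y] assms(3)[of y x] \<open>x \<in> I\<close> that
      by (cases "x \<le> y") (simp_all add: dist_real_def abs_minus_commute)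
    also have "\<dots> < e" using that(2) assms(2) by (simp add: dist_real_def field_simps)
    finally show ?thesis by (simp add: dist_real_def)
  qed
  moreover have "min \<alpha> (e / K) > 0" using assms(1,2) \<open>0 < e\<close> by simp
  ultimately show "\<exists>d>0. \<forall>y\<in>I. dist y x < d \<longrightarrow> dist (v y) (v x) < e" by blast
qed

theorem lemmaA4:
  fixes M :: "'w measure" and X :: "'w \<Rightarrow> real" and A :: "real set"
    and Q :: "real \<Rightarrow> 'w measure" and \<Xi> :: "('w \<Rightarrow> real) set"
    and c u :: "real \<Rightarrow> real" and I :: "real set" and \<alpha>bar K :: real
  assumes "principal_agent M X A Q \<Xi> c u"
    and "admissible M X A Q \<Xi> u"
    and "open I" and "is_interval I"
    and "\<alpha>bar > 0" and "K > 0"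
    and "\<And>R. R \<in> I \<Longrightarrow>
      \<exists>(\<xi>, a) \<in> PA_solutions A Q \<Xi> X u c R.
        upper_gap M u \<xi> > ereal \<alpha>bar \<and>
        integrable (Q a) (\<lambda>\<omega>. 1 / deriv u (perturbed u \<xi> \<alpha>bar \<omega>)) \<and>
        (\<integral>\<omega>. 1 / deriv u (perturbed u \<xi> \<alpha>bar \<omega>) \<partial>Q a) \<le> K"
  shows "continuous_on I (PA_value A Q \<Xi> X u c)"
proof -
  let ?V = "PA_value A Q \<Xi> X u c"
  \<comment> \<open>The value is attained on \<open>I\<close>, hence finite there, and can be treated as a real function.\<close>
  define v where "v R = real_of_ereal (?V R)" for R
  have V: "?V R = ereal (v R)"
    and drop: "\<And>\<delta>. 0 \<le> \<delta> \<Longrightarrow> \<delta> \<le> \<alpha>bar \<Longrightarrow> ereal (v R - K * \<delta>) \<le> ?V (R + \<delta>)"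
    if R: "R \<in> I" for R
  proof -
    obtain \<xi> a where sol: "(\<xi>, a) \<in> PA_solutions A Q \<Xi> X u c R"
      and hyps: "ereal \<alpha>bar < upper_gap M u \<xi>"
        "integrable (Q a) (\<lambda>\<omega>. 1 / deriv u (perturbed u \<xi> \<alpha>bar \<omega>))"
        "(\<integral>\<omega>. 1 / deriv u (perturbed u \<xi> \<alpha>bar \<omega>) \<partial>Q a) \<le> K"
      using assms(7)[OF R] by blast
    have feas: "(\<xi>, a) \<in> feasible A Q \<Xi> u c R"
      and attained: "ereal (principal_profit Q X \<xi> a) = ?V R"
      using sol by (auto simp: PA_solutions_def)
    have v: "v R = principal_profit Q X \<xi> a"
      unfolding v_def attained[symmetric] by simp
    then show "?V R = ereal (v R)" using attained by simp
    show "ereal (v R - K * \<delta>) \<le> ?V (R + \<delta>)" if "0 \<le> \<delta>" "\<delta> \<le> \<alpha>bar" for \<delta>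
      unfolding v
      using principal_agent.PA_value_perturbation[OF assms(1,2) feas that hyps] .
  qed
  have "continuous_on I v"
  proof (rule continuous_on_of_lipschitz_at_scale[OF assms(5,6)])
    fix R R' assume R: "R \<in> I" "R' \<in> I" "R \<le> R'" "R' - R \<le> \<alpha>bar"
    have "v R - K * (R' - R) \<le> v R'"
      using drop[OF R(1), of "R' - R"] R V[OF R(2)] by simp
    moreover have "v R' \<le> v R"
      using PA_value_antimono[OF R(3), of A Q \<Xi> X u c] V[OF R(1)] V[OF R(2)] by simp
    ultimately show "\<bar>v R' - v R\<bar> \<le> K * (R' - R)" by simp
  qed
  then have "continuous_on I (\<lambda>R. ereal (v R))" by (rule continuous_on_ereal)
  then show ?thesis using V by (simp cong: continuous_on_cong)
qed

end
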